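(* Let $\eta$ be a (positive) Borel measure on $[0,1)$ such that $\varkappa_\eta$ is a bounded function. Then $\gamma_\eta$ is Lipschitz continuous with respect to $d_{\log}$, that is, there exists a constant $C\ge0$ such that $|\gamma_\eta(m)-\gamma_\eta(n)|\le C\,d_{\log}(m,n)$ for all $m,n\in\mathbb{N}_0$.
   Context: $\mathbb{N}_0=\{0,1,2,\ldots\}$. For a Borel measure $\eta$ on $[0,1)$: $\varkappa_\eta(r)=\frac{2\,\eta([r,1))}{1-r^2}$ for $r\in[0,1)$ (boundedness of $\varkappa_\eta$ means boundedness by a finite real constant), and $\gamma_\eta(k)=2(k+1)\int_{[0,1)}r^{2k}\,\mathrm{d}\eta(r)$ for $k\in\mathbb{N}_0$. The logarithmic distance on $\mathbb{N}_0$ is $d_{\log}(m,n)=|\log(m+1)-\log(n+1)|$. *)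

theory Defs
  imports "HOL-Analysis.Analysis"
begin

text \<open>
  The measure \<open>\<eta>\<close> is not assumed to be finite, so \<open>\<kappa>\<^sub>\<eta>\<close> takes values in
  \<open>[0, \<infinity>]\<close>. It is only meant for \<open>r \<in> [0, 1)\<close>, where the denominator is positive.
\<close>
definition kappa :: "real measure \<Rightarrow> real \<Rightarrow> ennreal" where
  "kappa \<eta> r = 2 * emeasure \<eta> {r..<1} / ennreal (1 - r\<^sup>2)"

definition kappa_bounded :: "real measure \<Rightarrow> bool" where
  "kappa_bounded \<eta> \<longleftrightarrow> (\<exists>B::real. \<forall>r\<in>{0..<1}. kappa \<eta> r \<le> ennreal B)"

text \<open>
  The whole space of \<open>\<eta>\<close> is to be \<open>[0, 1)\<close>. If \<open>\<kappa>\<^sub>\<eta>\<close> is bounded, its value at \<open>0\<close> shows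
  that \<open>\<eta>\<close> is finite, so the integrands below are integrable and the default value \<open>0\<close> of
  the Bochner integral does not occur.
\<close>
definition gamma :: "real measure \<Rightarrow> nat \<Rightarrow> real" where
  "gamma \<eta> k = 2 * (real k + 1) * (LINT r|\<eta>. r ^ (2 * k))"

definition d_log :: "nat \<Rightarrow> nat \<Rightarrow> real" where
  "d_log m n = \<bar>ln (real m + 1) - ln (real n + 1)\<bar>"

end

theory Submission
  imports Defs
begin

text \<open>
  Boundedness of \<open>\<kappa>\<^sub>\<eta>\<close> says \<open>\<eta>([t,1)) \<le> K (1 - t)\<close>, whence the layer-cake formula gives the
  moment bound \<open>\<integral> r^n d\<eta> \<le> K / (n + 1)\<close>. The increment \<open>\<gamma>\<^sub>\<eta>(k+1) - \<gamma>\<^sub>\<eta>(k)\<close> is twice the integral of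
  \<open>r^(2k+2) - (k+1) r^(2k) (1 - r\<^sup>2)\<close>, and \<open>(k+1) r^(2k) (1 - r\<^sup>2) \<le> 2 r^k\<close> because
  \<open>(k+1) r^k (1 - r) \<le> (1 - r) (1 + r + \<dots> + r^k) \<le> 1\<close>. So the increment is \<open>O(1/(k+2))\<close>, which is
  dominated by \<open>ln (k+2) - ln (k+1)\<close>.
\<close>

text \<open>The factor 1 + t of 1 - t^2 is at most 2, so the denominator is comparable to 1 - t. The
  bound stays in \<open>ennreal\<close>, since finiteness of \<eta> is itself a consequence of
  it.\<close>

lemma kappa_bounded_tail_le:
  assumes "kappa_bounded \<eta>"
  obtains K where "K \<ge> 0" "\<And>t. t \<in> {0..<1} \<Longrightarrow> emeasure \<eta> {t..<1} \<le> ennreal (K * (1 - t))"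
proof -
  obtain B where B: "\<And>r. r \<in> {0..<1} \<Longrightarrow> kappa \<eta> r \<le> ennreal B"
    using assms unfolding kappa_bounded_def by blast
  \<comment> \<open>\<open>ennreal\<close> sends negative reals to 0, so B may be replaced by its
    positive part, on which \<open>ennreal\<close> is multiplicative. The 2 bounds 1 + t; the factor
    2 in \<open>kappa\<close> is simply dropped at the end.\<close>
  define K where "K = 2 * max B 0"
  have "emeasure \<eta> {t..<1} \<le> ennreal (K * (1 - t))" if t: "t \<in> {0..<1}" for t
  proof -
    have pos: "0 < 1 - t\<^sup>2"
      using t by (simp add: power_less_one_iff abs_square_less_1)
    have "2 * emeasure \<eta> {t..<1} / ennreal (1 - t\<^sup>2) \<le> ennreal (max B 0)"
      using B[OF t] order_trans[OF _ ennreal_leI[of B "max B 0"]] by (simp add: kappa_def)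
    then have "2 * emeasure \<eta> {t..<1} / ennreal (1 - t\<^sup>2) * ennreal (1 - t\<^sup>2)
        \<le> ennreal (max B 0) * ennreal (1 - t\<^sup>2)"
      by (rule mult_right_mono) simp
    then have "2 * emeasure \<eta> {t..<1} \<le> ennreal (max B 0) * ennreal (1 - t\<^sup>2)"
      using pos by (simp add: ennreal_divide_times)
    also have "\<dots> = ennreal (max B 0 * (1 - t\<^sup>2))"
      by (rule ennreal_mult[symmetric]) (use pos in auto)
    also have "\<dots> \<le> ennreal (K * (1 - t))"
    proof (rule ennreal_leI)
      have "1 - t\<^sup>2 = (1 + t) * (1 - t)" by (simp add: power2_eq_square algebra_simps)
      also have "\<dots> \<le> 2 * (1 - t)" using t by (intro mult_right_mono) auto
      finally have "max B 0 * (1 - t\<^sup>2) \<le> max B 0 * (2 * (1 - t))"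
        by (rule mult_left_mono) simp
      then show "max B 0 * (1 - t\<^sup>2) \<le> K * (1 - t)" by (simp add: K_def algebra_simps)
    qed
    finally have "2 * emeasure \<eta> {t..<1} \<le> ennreal (K * (1 - t))" .
    moreover have "emeasure \<eta> {t..<1} \<le> 2 * emeasure \<eta> {t..<1}"
      by (simp add: mult_2)
    ultimately show ?thesis by (rule order_trans[rotated])
  qed
  moreover have "K \<ge> 0" by (simp add: K_def)
  ultimately show thesis using that by blast
qed

text \<open>Layer cake: r^(m+1) is the integral of (m+1) t^m over [0,r], and Tonelli's theorem swaps
  the two integrals; for fixed t \<ge> 0 the points r with t \<le> r form the tail.\<close>

lemma nn_integral_power_eq_tail:
  fixes \<eta> :: "real measure"
  assumes sets: "sets \<eta> = sets (restrict_space borel {0..<1})" and "sigma_finite_measure \<eta>"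
  shows "(\<integral>\<^sup>+r. ennreal (r ^ Suc m) \<partial>\<eta>) =
    (\<integral>\<^sup>+t. ennreal (real (Suc m) * t ^ m) * emeasure \<eta> {t..<1} * indicator {0..1} t \<partial>lborel)"
proof -
  interpret sigma_finite_measure \<eta> by fact
  interpret pair_sigma_finite lborel \<eta> ..
  have space: "space \<eta> = {0..<1}"
    using sets_eq_imp_space_eq[OF sets] by (simp add: space_restrict_space)
  have id_meas [measurable]: "(\<lambda>r. r) \<in> \<eta> \<rightarrow>\<^sub>M borel"
    unfolding measurable_cong_sets[OF sets refl] by (rule measurable_restrict_space1) simp
  define f where "f = (\<lambda>(t, r). ennreal (real (Suc m) * t ^ m) * indicator {p::real \<times> real. 0 \<le> fst p \<and> fst p \<le> snd p} (t, r))"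
  have f_meas [measurable]: "f \<in> borel_measurable (lborel \<Otimes>\<^sub>M \<eta>)"
    unfolding f_def split_beta indicator_def by measurable
  have inner_t: "(\<integral>\<^sup>+t. f (t, r) \<partial>lborel) = ennreal (r ^ Suc m)" if "r \<in> space \<eta>" for r
  proof -
    have "(\<integral>\<^sup>+t. f (t, r) \<partial>lborel) = (\<integral>\<^sup>+t. ennreal (real (Suc m) * t ^ m) * indicator {0..r} t \<partial>lborel)"
      by (intro nn_integral_cong) (auto simp: f_def indicator_def)
    also have "\<dots> = ennreal (r ^ Suc m - 0 ^ Suc m)"
      by (rule nn_integral_FTC_Icc)
         (use that DERIV_pow[of "Suc m"] in \<open>auto simp: space simp del: power_Suc of_nat_Suc\<close>)
    finally show ?thesis by simp
  qed
  have inner_r: "(\<integral>\<^sup>+r. f (t, r) \<partial>\<eta>) =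
      ennreal (real (Suc m) * t ^ m) * emeasure \<eta> {t..<1} * indicator {0..1} t" for t
  proof (cases "0 \<le> t")
    case True
    have "{t..<1} \<in> sets \<eta>"
      unfolding sets using True by (auto simp: sets_restrict_space_iff)
    moreover have "(\<integral>\<^sup>+r. f (t, r) \<partial>\<eta>) = (\<integral>\<^sup>+r. ennreal (real (Suc m) * t ^ m) * indicator {t..<1} r \<partial>\<eta>)"
      by (intro nn_integral_cong) (use True in \<open>auto simp: f_def indicator_def space\<close>)
    ultimately have "(\<integral>\<^sup>+r. f (t, r) \<partial>\<eta>) = ennreal (real (Suc m) * t ^ m) * emeasure \<eta> {t..<1}"
      by (simp add: nn_integral_cmult_indicator)
    \<comment> \<open>For 1 < t the tail is empty, so cutting off at 1 loses nothing.\<close>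
    then show ?thesis using True by (cases "t \<le> 1") auto
  qed (auto simp: f_def)
  have "(\<integral>\<^sup>+r. ennreal (r ^ Suc m) \<partial>\<eta>) = (\<integral>\<^sup>+r. (\<integral>\<^sup>+t. f (t, r) \<partial>lborel) \<partial>\<eta>)"
    by (intro nn_integral_cong) (simp only: inner_t)
  also have "\<dots> = (\<integral>\<^sup>+t. (\<integral>\<^sup>+r. f (t, r) \<partial>\<eta>) \<partial>lborel)"
    by (rule Fubini[OF f_meas])
  finally show ?thesis by (simp only: inner_r)
qed

text \<open>For n > 0, inserting the tail bound into the layer-cake formula leaves K n times the
  Beta integral of t^(n-1) (1 - t) over [0,1], which is 1 / (n (n+1)).\<close>

lemma nn_integral_power_le_of_tail_le:
  fixes \<eta> :: "real measure"
  assumes sets: "sets \<eta> = sets (restrict_space borel {0..<1})" and "K \<ge> 0"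
    and tail: "\<And>t. t \<in> {0..<1} \<Longrightarrow> emeasure \<eta> {t..<1} \<le> ennreal (K * (1 - t))"
  shows "(\<integral>\<^sup>+r. ennreal (r ^ n) \<partial>\<eta>) \<le> ennreal (K / real (n + 1))"
proof -
  have space: "space \<eta> = {0..<1}"
    using sets_eq_imp_space_eq[OF sets] by (simp add: space_restrict_space)
  \<comment> \<open>The tail at 0 is the whole space: this settles n = 0 and makes \<eta> finite,
    hence \<sigma>-finite as Tonelli's theorem requires.\<close>
  have total: "emeasure \<eta> (space \<eta>) \<le> ennreal K"
    using tail[of 0] by (simp add: space)
  then interpret finite_measure \<eta>
    by (intro finite_measureI) (auto simp: top_unique)
  show ?thesis
  proof (cases n)
    case 0
    then show ?thesis using total by simp
  next
    case (Suc m)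
    have "(\<integral>\<^sup>+r. ennreal (r ^ n) \<partial>\<eta>) =
        (\<integral>\<^sup>+t. ennreal (real (Suc m) * t ^ m) * emeasure \<eta> {t..<1} * indicator {0..1} t \<partial>lborel)"
      unfolding Suc by (rule nn_integral_power_eq_tail[OF sets sigma_finite_measure_axioms])
    also have "\<dots> \<le> (\<integral>\<^sup>+t. ennreal (K * (real (Suc m) * t ^ m - real (Suc m) * t ^ Suc m)) * indicator {0..1} t \<partial>lborel)"
    proof (rule nn_integral_mono)
      fix t :: real
      show "ennreal (real (Suc m) * t ^ m) * emeasure \<eta> {t..<1} * indicator {0..1} t \<le>
        ennreal (K * (real (Suc m) * t ^ m - real (Suc m) * t ^ Suc m)) * indicator {0..1} t"
      proof (cases "t \<in> {0..<1}")
        case True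
        then have "ennreal (real (Suc m) * t ^ m) * emeasure \<eta> {t..<1}
            \<le> ennreal (real (Suc m) * t ^ m) * ennreal (K * (1 - t))"
          by (intro mult_left_mono tail) auto
        also have "\<dots> = ennreal (real (Suc m) * t ^ m * (K * (1 - t)))"
          by (rule ennreal_mult[symmetric]) (use True \<open>K \<ge> 0\<close> in auto)
        also have "real (Suc m) * t ^ m * (K * (1 - t)) = K * (real (Suc m) * t ^ m - real (Suc m) * t ^ Suc m)"
          by (simp add: algebra_simps)
        finally show ?thesis by (intro mult_right_mono) auto
      \<comment> \<open>At t = 1 the tail is empty; at all other remaining t the indicator
        vanishes.\<close>
      qed (cases "t = 1"; auto)
    qed
    also have "\<dots> = ennreal (K * (1 ^ Suc m - real (Suc m) / real (Suc (Suc m)) * 1 ^ Suc (Suc m))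
        - K * (0 ^ Suc m - real (Suc m) / real (Suc (Suc m)) * 0 ^ Suc (Suc m)))"
    proof (rule nn_integral_FTC_Icc[where F = "\<lambda>t. K * (t ^ Suc m - real (Suc m) / real (Suc (Suc m)) * t ^ Suc (Suc m))"])
      fix t :: real
      assume t: "t \<in> {0..1}"
      \<comment> \<open>The quotient is abstracted to c, so that the derivative is taken first and
        \<open>real (Suc (Suc m))\<close> cancels only afterwards.\<close>
      have "((\<lambda>t. K * (t ^ Suc m - c * t ^ Suc (Suc m))) has_real_derivative
          K * (real (Suc m) * t ^ m - c * (real (Suc (Suc m)) * t ^ Suc m))) (at t)" for c
        using DERIV_cmult[OF DERIV_diff[OF DERIV_pow[of "Suc m"] DERIV_cmult[OF DERIV_pow[of "Suc (Suc m)"]]], of K c t]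
        by (simp del: power_Suc of_nat_Suc)
      from this[of "real (Suc m) / real (Suc (Suc m))"]
      show "((\<lambda>t. K * (t ^ Suc m - real (Suc m) / real (Suc (Suc m)) * t ^ Suc (Suc m))) has_real_derivative
          K * (real (Suc m) * t ^ m - real (Suc m) * t ^ Suc m)) (at t)"
        by (simp del: power_Suc of_nat_Suc)
      have "t ^ Suc m \<le> t ^ m" using t by (intro power_decreasing) auto
      then show "0 \<le> K * (real (Suc m) * t ^ m - real (Suc m) * t ^ Suc m)"
        using \<open>K \<ge> 0\<close> by (simp del: power_Suc of_nat_Suc)
    qed auto
    also have "K * (1 ^ Suc m - real (Suc m) / real (Suc (Suc m)) * 1 ^ Suc (Suc m))
        - K * (0 ^ Suc m - real (Suc m) / real (Suc (Suc m)) * 0 ^ Suc (Suc m)) = K / real (n + 1)"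
      by (simp add: Suc field_simps)
    finally show ?thesis .
  qed
qed

lemma Suc_mult_power_one_minus_le_one:
  fixes r :: real
  assumes "0 \<le> r" "r \<le> 1"
  shows "real (Suc k) * r ^ k * (1 - r) \<le> 1"
proof -
  have "real (Suc k) * r ^ k = (\<Sum>j<Suc k. r ^ k)" by simp
  also have "\<dots> \<le> (\<Sum>j<Suc k. r ^ j)"
    using assms by (intro sum_mono power_decreasing) auto
  finally have "real (Suc k) * r ^ k * (1 - r) \<le> (\<Sum>j<Suc k. r ^ j) * (1 - r)"
    using assms by (intro mult_right_mono) auto
  also have "\<dots> = 1 - r ^ Suc k"
    using one_diff_power_eq[of r "Suc k"] by (simp add: mult.commute)
  also have "\<dots> \<le> 1" using assms by simp
  finally show ?thesis .
qed

text \<open>Bounding the two values of \<open>gamma\<close> separately would give only O(1); the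
  decay comes from the difference of consecutive even moments. Half of r^(2k) absorbs the factor
  (k+1) (1 - r), the other half leaves the k-th moment, which is still O(1/k).\<close>

lemma gamma_increment_le:
  fixes \<eta> :: "real measure"
  assumes int: "\<And>n. integrable \<eta> (\<lambda>r. r ^ n)"
    and space: "space \<eta> \<subseteq> {0..1}"
    and moment: "\<And>n. (LINT r|\<eta>. r ^ n) \<le> K / real (n + 1)" and "K \<ge> 0"
  shows "\<bar>gamma \<eta> (Suc k) - gamma \<eta> k\<bar> \<le> 8 * K / real (k + 2)"
proof -
  define a where "a n = (LINT r|\<eta>. r ^ n)" for n
  have pointwise: "real (Suc k) * (r ^ (2 * k) - r ^ (2 * k + 2)) \<le> 2 * r ^ k" if r: "r \<in> space \<eta>" for r
  proof -
    have r': "0 \<le> r" "r \<le> 1" using r space by auto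
    have "real (Suc k) * (r ^ (2 * k) - r ^ (2 * k + 2)) = (real (Suc k) * r ^ k * (1 - r)) * ((1 + r) * r ^ k)"
      by (simp add: algebra_simps power_add mult_2 mult_2_right power2_eq_square)
    also have "\<dots> \<le> 1 * ((1 + r) * r ^ k)"
      by (rule mult_right_mono[OF Suc_mult_power_one_minus_le_one[OF r']]) (use r' in auto)
    also have "\<dots> \<le> 2 * r ^ k" using r' by (simp add: mult_right_mono)
    finally show ?thesis .
  qed
  have "real (Suc k) * (a (2 * k) - a (2 * k + 2)) = (LINT r|\<eta>. real (Suc k) * (r ^ (2 * k) - r ^ (2 * k + 2)))"
    unfolding a_def by (simp only: Bochner_Integration.integral_diff[OF int int] integral_mult_right_zero)
  also have "\<dots> \<le> (LINT r|\<eta>. 2 * r ^ k)"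
    by (intro integral_mono pointwise integrable_mult_right Bochner_Integration.integrable_diff int)
  also have "\<dots> = 2 * a k" by (simp add: a_def)
  finally have upper: "real (Suc k) * (a (2 * k) - a (2 * k + 2)) \<le> 2 * a k" .
  have lower: "a (2 * k + 2) \<le> a (2 * k)"
    unfolding a_def by (intro integral_mono int power_decreasing) (use space in auto)
  have nonneg: "a n \<ge> 0" for n
    unfolding a_def by (intro integral_nonneg_AE AE_I2) (use space in auto)
  have "a (2 * k + 2) \<le> K / real (2 * k + 2 + 1)" unfolding a_def by (rule moment)
  also have "\<dots> \<le> K / real (k + 2)" using \<open>K \<ge> 0\<close> by (intro divide_left_mono) auto
  finally have first: "a (2 * k + 2) \<le> K / real (k + 2)" .
  have "a k \<le> K / real (k + 1)" unfolding a_def by (rule moment)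
  \<comment> \<open>k + 2 \<le> 2 (k + 1) brings both moment bounds to the same denominator.\<close>
  also have "\<dots> \<le> 2 * (K / real (k + 2))"
    using \<open>K \<ge> 0\<close> by (simp add: field_simps mult_left_mono)
  finally have second: "a k \<le> 2 * (K / real (k + 2))" .
  define M where "M = K / real (k + 2)"
  define D where "D = real (Suc k) * (a (2 * k) - a (2 * k + 2))"
  \<comment> \<open>Both terms of the difference are nonnegative, so its absolute value is at most
    the larger one: the moment is at most M, and D \<le> 2 \<open>a k\<close> \<le> 4 M. The outer
    factor 2 makes this 8 M.\<close>
  have eq: "gamma \<eta> (Suc k) - gamma \<eta> k = 2 * (a (2 * k + 2) - D)"
    by (simp add: gamma_def a_def D_def algebra_simps)
  have "0 \<le> D" using lower by (simp add: D_def)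
  moreover have "0 \<le> M" using \<open>K \<ge> 0\<close> by (simp add: M_def)
  ultimately have "\<bar>gamma \<eta> (Suc k) - gamma \<eta> k\<bar> \<le> 8 * M"
    unfolding eq using upper[folded D_def] first[folded M_def] second[folded M_def] nonneg[of "2 * k + 2"]
    by (simp add: abs_le_iff)
  then show ?thesis by (simp add: M_def)
qed

lemma d_log_Lipschitz_of_increment_le:
  fixes g :: "nat \<Rightarrow> real"
  assumes incr: "\<And>k. \<bar>g (Suc k) - g k\<bar> \<le> C / real (k + 2)" and "C \<ge> 0"
  shows "\<bar>g m - g n\<bar> \<le> C * d_log m n"
proof -
  \<comment> \<open>This is ln x \<le> x - 1 at x = (k+1)/(k+2), where x - 1 = -1/(k+2).\<close>
  have step: "1 / real (k + 2) \<le> ln (real k + 2) - ln (real k + 1)" for k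
  proof -
    have "ln ((real k + 1) / (real k + 2)) \<le> (real k + 1) / (real k + 2) - 1"
      by (rule ln_le_minus_one) simp
    then show ?thesis by (simp add: ln_div field_simps)
  qed
  \<comment> \<open>For i \<le> j the logarithms are ordered, so the absolute value in
    \<open>d_log\<close> can be omitted and the increments telescope.\<close>
  have mono: "\<bar>g j - g i\<bar> \<le> C * (ln (real j + 1) - ln (real i + 1))" if "i \<le> j" for i j
    using that
  proof (induction j rule: dec_induct)
    case (step j)
    have "C / real (j + 2) \<le> C * (ln (real j + 2) - ln (real j + 1))"
      using mult_left_mono[OF \<open>\<And>k. 1 / real (k + 2) \<le> _\<close>[of j] \<open>C \<ge> 0\<close>] by simp
    then have "\<bar>g (Suc j) - g i\<bar> \<le> C * (ln (real j + 2) - ln (real j + 1)) + C * (ln (real j + 1) - ln (real i + 1))"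
      using incr[of j] step.IH by linarith
    then show ?case by (simp add: algebra_simps)
  qed simp
  show ?thesis
  proof (cases "m \<le> n")
    case True
    then show ?thesis using mono[OF True] by (simp add: d_log_def abs_minus_commute)
  next
    case False
    then show ?thesis using mono[of n m] by (simp add: d_log_def)
  qed
qed

theorem theorem7p3:
  fixes \<eta> :: "real measure"
  assumes "sets \<eta> = sets (restrict_space borel {0..<1})"
    and "kappa_bounded \<eta>"
  shows "\<exists>C\<ge>0. \<forall>m n. \<bar>gamma \<eta> m - gamma \<eta> n\<bar> \<le> C * d_log m n"
proof -
  obtain K where K: "K \<ge> 0" "\<And>t. t \<in> {0..<1} \<Longrightarrow> emeasure \<eta> {t..<1} \<le> ennreal (K * (1 - t))"
    using kappa_bounded_tail_le[OF assms(2)] by blast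
  have space: "space \<eta> = {0..<1}"
    using sets_eq_imp_space_eq[OF assms(1)] by (simp add: space_restrict_space)
  have [measurable]: "(\<lambda>r. r) \<in> \<eta> \<rightarrow>\<^sub>M borel"
    unfolding measurable_cong_sets[OF assms(1) refl] by (rule measurable_restrict_space1) simp
  have nn: "(\<integral>\<^sup>+r. ennreal (r ^ n) \<partial>\<eta>) \<le> ennreal (K / real (n + 1))" for n
    by (rule nn_integral_power_le_of_tail_le[OF assms(1) K])
  have AE_nonneg: "AE r in \<eta>. 0 \<le> r ^ n" for n
    by (intro AE_I2) (auto simp: space)
  \<comment> \<open>Finiteness of the nonnegative integral gives integrability, so the Bochner
    moments are the true ones and inherit the bound.\<close>
  have int: "integrable \<eta> (\<lambda>r. r ^ n)" for n
    using nn[of n] by (intro integrableI_nonneg AE_nonneg) (auto intro: le_less_trans)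
  have moment: "(LINT r|\<eta>. r ^ n) \<le> K / real (n + 1)" for n
    using nn[of n] K(1) by (simp add: nn_integral_eq_integral[OF int AE_nonneg] del: of_nat_add)
  have "\<bar>gamma \<eta> (Suc k) - gamma \<eta> k\<bar> \<le> 8 * K / real (k + 2)" for k
    by (rule gamma_increment_le[OF int _ moment K(1)]) (auto simp: space)
  then have "\<bar>gamma \<eta> m - gamma \<eta> n\<bar> \<le> 8 * K * d_log m n" for m n
    by (rule d_log_Lipschitz_of_increment_le) (use K(1) in simp)
  then show ?thesis using K(1) by (intro exI[of _ "8 * K"]) simp
qed

end
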